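(* For any Hausdorff topological semilattice $X$ the following statements hold. (1) If $X$ is $k$-complete, then $X$ is $s$-complete. (2) If $X$ is $s$-complete, then $X$ is $c$-complete. (3) If every maximal chain in $X$ is $c$-complete, then $X$ is $c$-complete.
   Context: A topological semilattice is a topological space $X$ with a continuous binary operation $(x,y)\mapsto xy$ that is associative, commutative and idempotent. The natural partial order on a semilattice is: $x\le y$ iff $xy=x$. A chain is a subset in which any two elements are comparable; a maximal chain is one maximal under inclusion. Each chain is a subsemilattice and is regarded as a topological semilattice with the subspace topology. For $A\subset X$, ${\downarrow}A=\{x\in X:\exists a\in A\ (x\le a)\}$ and ${\uparrow}A=\{x\in X:\exists a\in A\ (x\ge a)\}$; $A$ is an upper set if $A={\uparrow}A$. $\overline{A}$ denotes topological closure in $X$. A topological semilattice $X$ is: - $k$-complete if each non-empty chain $C\subset X$ has $\inf C\in\overline{C}$ and $\sup C\in\overline{C}$ (in particular, both exist in $X$); - $s$-complete if each non-empty subsemilattice $S\subset X$ has $\inf S\in\overline{{\uparrow}S}$ and each non-empty chain $C\subset X$ has $\sup C\in\overline{{\downarrow}C}$ (existence included); - $c$-complete if for each closed upper set $F\subset X$, each non-empty chain $C\subset F$ has $\inf C\in F$ and $\sup C\in\overline{{\downarrow}C}$ in $X$ (existence included). When these notions are applied to a maximal chain $M$, all order and topological notions are taken in $M$. *)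

theory Defs
  imports "HOL-Analysis.Analysis"
begin

text \<open>
  A topological semilattice is a topology \<open>X\<close> together with an operation \<open>m\<close>, only the values
  of \<open>m\<close> on \<open>topspace X\<close> being relevant. Every notion is relative to \<open>topspace X\<close>, so a chain
  \<open>M\<close> regarded as a topological semilattice in its own right is given by \<open>subtopology X M\<close>
  and the same \<open>m\<close>.
\<close>

text \<open>Continuity includes closure of \<open>topspace X\<close> under \<open>m\<close>.\<close>

definition topological_semilattice :: "'a topology \<Rightarrow> ('a \<Rightarrow> 'a \<Rightarrow> 'a) \<Rightarrow> bool" where
  "topological_semilattice X m \<longleftrightarrow>
     continuous_map (prod_topology X X) X (\<lambda>(x, y). m x y) \<and>
     (\<forall>x\<in>topspace X. \<forall>y\<in>topspace X. \<forall>z\<in>topspace X. m (m x y) z = m x (m y z)) \<and>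
     (\<forall>x\<in>topspace X. \<forall>y\<in>topspace X. m x y = m y x) \<and>
     (\<forall>x\<in>topspace X. m x x = x)"

definition sl_le :: "('a \<Rightarrow> 'a \<Rightarrow> 'a) \<Rightarrow> 'a \<Rightarrow> 'a \<Rightarrow> bool" where
  "sl_le m x y \<longleftrightarrow> m x y = x"

text \<open>
  The locale \<open>pred_on\<close> compares by the reflexive closure of the given relation, which
  changes nothing here: idempotence already makes \<open>sl_le m\<close> reflexive on \<open>topspace X\<close>.
\<close>

abbreviation sl_chain :: "'a topology \<Rightarrow> ('a \<Rightarrow> 'a \<Rightarrow> 'a) \<Rightarrow> 'a set \<Rightarrow> bool" where
  "sl_chain X m \<equiv> pred_on.chain (topspace X) (sl_le m)"

abbreviation sl_maximal_chain :: "'a topology \<Rightarrow> ('a \<Rightarrow> 'a \<Rightarrow> 'a) \<Rightarrow> 'a set \<Rightarrow> bool" where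
  "sl_maximal_chain X m \<equiv> pred_on.maxchain (topspace X) (sl_le m)"

definition subsemilattice :: "'a topology \<Rightarrow> ('a \<Rightarrow> 'a \<Rightarrow> 'a) \<Rightarrow> 'a set \<Rightarrow> bool" where
  "subsemilattice X m S \<longleftrightarrow> S \<subseteq> topspace X \<and> (\<forall>x\<in>S. \<forall>y\<in>S. m x y \<in> S)"

definition down_closure :: "'a topology \<Rightarrow> ('a \<Rightarrow> 'a \<Rightarrow> 'a) \<Rightarrow> 'a set \<Rightarrow> 'a set" where
  "down_closure X m A = {x \<in> topspace X. \<exists>a\<in>A. sl_le m x a}"

definition up_closure :: "'a topology \<Rightarrow> ('a \<Rightarrow> 'a \<Rightarrow> 'a) \<Rightarrow> 'a set \<Rightarrow> 'a set" where
  "up_closure X m A = {x \<in> topspace X. \<exists>a\<in>A. sl_le m a x}"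

definition upper_set :: "'a topology \<Rightarrow> ('a \<Rightarrow> 'a \<Rightarrow> 'a) \<Rightarrow> 'a set \<Rightarrow> bool" where
  "upper_set X m A \<longleftrightarrow> A = up_closure X m A"

text \<open>
  Infima and suprema are relations, so that \<open>\<exists>x. is_inf X m A x \<and> \<dots>\<close> asserts existence
  as well; in a semilattice they are unique by antisymmetry.
\<close>

definition is_inf :: "'a topology \<Rightarrow> ('a \<Rightarrow> 'a \<Rightarrow> 'a) \<Rightarrow> 'a set \<Rightarrow> 'a \<Rightarrow> bool" where
  "is_inf X m A x \<longleftrightarrow>
     x \<in> topspace X \<and> (\<forall>a\<in>A. sl_le m x a) \<and>
     (\<forall>b\<in>topspace X. (\<forall>a\<in>A. sl_le m b a) \<longrightarrow> sl_le m b x)"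

definition is_sup :: "'a topology \<Rightarrow> ('a \<Rightarrow> 'a \<Rightarrow> 'a) \<Rightarrow> 'a set \<Rightarrow> 'a \<Rightarrow> bool" where
  "is_sup X m A x \<longleftrightarrow>
     x \<in> topspace X \<and> (\<forall>a\<in>A. sl_le m a x) \<and>
     (\<forall>b\<in>topspace X. (\<forall>a\<in>A. sl_le m a b) \<longrightarrow> sl_le m x b)"

definition k_complete :: "'a topology \<Rightarrow> ('a \<Rightarrow> 'a \<Rightarrow> 'a) \<Rightarrow> bool" where
  "k_complete X m \<longleftrightarrow>
     (\<forall>C. sl_chain X m C \<and> C \<noteq> {} \<longrightarrow>
        (\<exists>x. is_inf X m C x \<and> x \<in> X closure_of C) \<and>
        (\<exists>x. is_sup X m C x \<and> x \<in> X closure_of C))"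

definition s_complete :: "'a topology \<Rightarrow> ('a \<Rightarrow> 'a \<Rightarrow> 'a) \<Rightarrow> bool" where
  "s_complete X m \<longleftrightarrow>
     (\<forall>S. subsemilattice X m S \<and> S \<noteq> {} \<longrightarrow>
        (\<exists>x. is_inf X m S x \<and> x \<in> X closure_of (up_closure X m S))) \<and>
     (\<forall>C. sl_chain X m C \<and> C \<noteq> {} \<longrightarrow>
        (\<exists>x. is_sup X m C x \<and> x \<in> X closure_of (down_closure X m C)))"

definition c_complete :: "'a topology \<Rightarrow> ('a \<Rightarrow> 'a \<Rightarrow> 'a) \<Rightarrow> bool" where
  "c_complete X m \<longleftrightarrow>
     (\<forall>F. closedin X F \<and> upper_set X m F \<longrightarrow>
        (\<forall>C. sl_chain X m C \<and> C \<noteq> {} \<and> C \<subseteq> F \<longrightarrow>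
           (\<exists>x. is_inf X m C x \<and> x \<in> F) \<and>
           (\<exists>x. is_sup X m C x \<and> x \<in> X closure_of (down_closure X m C))))"

end

theory Submission
  imports Defs
begin

text \<open>
  In a Hausdorff topological semilattice the principal filters and principal ideals are closed, so
  a lower (upper) bound of a set stays one for the closure of the upper (lower) set it generates.

  For (1), the closure of \<open>\<up>S\<close> is a subsemilattice closed under infima of chains. By Zorn's lemma
  it has a minimal element, which is then the least one, and hence the infimum of \<open>S\<close>.
  For (3), extend the chain \<open>C\<close> to a maximal chain \<open>M\<close>. If \<open>b\<close> is a lower bound of \<open>C\<close> in \<open>X\<close>, then
  \<open>M \<inter> \<up>b\<close> is a closed upper set of \<open>M\<close> containing \<open>C\<close>, so it contains the infimum of \<open>C\<close> in \<open>M\<close>,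
  which is therefore also the infimum in \<open>X\<close>.
\<close>

section \<open>Chains and their extension to maximal chains\<close>

lemma sl_chain_iff:
  assumes "topological_semilattice X m"
  shows "sl_chain X m C \<longleftrightarrow> C \<subseteq> topspace X \<and> (\<forall>x\<in>C. \<forall>y\<in>C. sl_le m x y \<or> sl_le m y x)"
proof -
  have "sl_le m x x" if "x \<in> topspace X" for x
    using assms that by (simp add: topological_semilattice_def sl_le_def)
  then show ?thesis
    unfolding pred_on.chain_def by (simp, blast)
qed

text \<open>A relative Hausdorff maximality principle: Zorn's lemma is applied only to the chains
  that contain \<open>C\<close>, and a maximal one among these is maximal among all chains.\<close>

lemma sl_maximal_chain_extends:
  assumes "sl_chain X m C"
  obtains M where "sl_maximal_chain X m M" "C \<subseteq> M"
proof -
  let ?P = "{D. sl_chain X m D \<and> C \<subseteq> D}"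
  have "\<Union>\<C> \<in> ?P" if "\<C> \<noteq> {}" "subset.chain ?P \<C>" for \<C>
  proof -
    have sub: "\<C> \<subseteq> ?P" and tot: "\<And>D E. D \<in> \<C> \<Longrightarrow> E \<in> \<C> \<Longrightarrow> D \<subseteq> E \<or> E \<subseteq> D"
      using that(2) by (auto simp: subset_chain_def)
    have chain: "sl_chain X m D" if "D \<in> \<C>" for D
      using sub that by blast
    have "sl_chain X m (\<Union>\<C>)"
    proof (rule pred_on.chainI)
      show "\<Union>\<C> \<subseteq> topspace X"
        using chain unfolding pred_on.chain_def by blast
      fix x y
      assume "x \<in> \<Union>\<C>" "y \<in> \<Union>\<C>"
      then obtain D E where "D \<in> \<C>" "E \<in> \<C>" "x \<in> D" "y \<in> E"
        by blast
      \<comment> \<open>\<open>B\<close> is the larger of \<open>D\<close> and \<open>E\<close>, so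
        a single chain compares \<open>x\<close> with \<open>y\<close>.\<close>
      with tot[of D E] obtain B where "B \<in> \<C>" "x \<in> B" "y \<in> B"
        by blast
      then show "(sl_le m)\<^sup>=\<^sup>= x y \<or> (sl_le m)\<^sup>=\<^sup>= y x"
        using pred_on.chain_total[OF chain] by metis
    qed
    with sub that(1) show ?thesis
      by blast
  qed
  moreover have "?P \<noteq> {}"
    using assms by blast
  ultimately have "\<exists>M\<in>?P. \<forall>D\<in>?P. M \<subseteq> D \<longrightarrow> D = M"
    by (intro subset_Zorn_nonempty)
  then obtain M where M: "M \<in> ?P" "\<forall>D\<in>?P. M \<subseteq> D \<longrightarrow> D = M"
    by (elim bexE)
  then have "sl_maximal_chain X m M"
    unfolding pred_on.maxchain_def by blast
  with M(1) that show ?thesis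
    by blast
qed

locale hausdorff_semilattice =
  fixes X :: "'a topology" and m :: "'a \<Rightarrow> 'a \<Rightarrow> 'a"
  assumes semilattice: "topological_semilattice X m"
    and Hausdorff: "Hausdorff_space X"
begin

section \<open>Order and topology of a Hausdorff semilattice\<close>

lemma continuous: "continuous_map (prod_topology X X) X (\<lambda>(x, y). m x y)"
  and assoc: "x \<in> topspace X \<Longrightarrow> y \<in> topspace X \<Longrightarrow> z \<in> topspace X \<Longrightarrow> m (m x y) z = m x (m y z)"
  and commute: "x \<in> topspace X \<Longrightarrow> y \<in> topspace X \<Longrightarrow> m x y = m y x"
  and idem: "x \<in> topspace X \<Longrightarrow> m x x = x"
  using semilattice unfolding topological_semilattice_def by blast+

lemma closed: "x \<in> topspace X \<Longrightarrow> y \<in> topspace X \<Longrightarrow> m x y \<in> topspace X"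
  using continuous by (force simp: continuous_map_def)

lemma le_refl: "x \<in> topspace X \<Longrightarrow> sl_le m x x"
  by (simp add: sl_le_def idem)

lemma le_trans:
  "sl_le m x y \<Longrightarrow> sl_le m y z \<Longrightarrow> x \<in> topspace X \<Longrightarrow> y \<in> topspace X \<Longrightarrow> z \<in> topspace X \<Longrightarrow> sl_le m x z"
  unfolding sl_le_def by (metis assoc)

lemma le_antisym:
  "sl_le m x y \<Longrightarrow> sl_le m y x \<Longrightarrow> x \<in> topspace X \<Longrightarrow> y \<in> topspace X \<Longrightarrow> x = y"
  unfolding sl_le_def by (metis commute)

lemma meet_le1: "x \<in> topspace X \<Longrightarrow> y \<in> topspace X \<Longrightarrow> sl_le m (m x y) x"
  unfolding sl_le_def by (metis assoc commute idem)

lemma meet_le2: "x \<in> topspace X \<Longrightarrow> y \<in> topspace X \<Longrightarrow> sl_le m (m x y) y"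
  unfolding sl_le_def by (metis assoc idem)

lemma le_meet:
  "sl_le m z x \<Longrightarrow> sl_le m z y \<Longrightarrow> x \<in> topspace X \<Longrightarrow> y \<in> topspace X \<Longrightarrow> z \<in> topspace X
    \<Longrightarrow> sl_le m z (m x y)"
  unfolding sl_le_def by (metis assoc)

lemma continuous_map_meet:
  assumes "continuous_map Y X f" "continuous_map Y X g"
  shows "continuous_map Y X (\<lambda>y. m (f y) (g y))"
  using continuous_map_compose[OF continuous_map_pairedI[OF assms] continuous]
  by (simp add: o_def)

text \<open>The filter is the equalizer of the continuous maps \<open>y\<close> \<mapsto>
  \<open>m b y\<close> and \<open>y\<close> \<mapsto> \<open>b\<close>, hence closed in a Hausdorff
  space. For the ideal below, the maps are \<open>y\<close> \<mapsto> \<open>m y b\<close> and the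
  identity.\<close>

lemma closedin_principal_filter:
  assumes "b \<in> topspace X"
  shows "closedin X {y \<in> topspace X. sl_le m b y}"
  unfolding sl_le_def using Hausdorff assms
  by (intro closedin_continuous_maps_eq[where Y=X] continuous_map_meet) auto

lemma closedin_principal_ideal:
  assumes "b \<in> topspace X"
  shows "closedin X {y \<in> topspace X. sl_le m y b}"
  unfolding sl_le_def using Hausdorff assms
  by (intro closedin_continuous_maps_eq[where Y=X] continuous_map_meet) auto

lemma up_closure_superset: "A \<subseteq> topspace X \<Longrightarrow> A \<subseteq> up_closure X m A"
  using le_refl by (auto simp: up_closure_def)

lemma down_closure_superset: "A \<subseteq> topspace X \<Longrightarrow> A \<subseteq> down_closure X m A"
  using le_refl by (auto simp: down_closure_def)

lemma lower_bound_closure_up_closure: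
  assumes "S \<subseteq> topspace X" "b \<in> topspace X" "\<forall>a\<in>S. sl_le m b a"
    and "y \<in> X closure_of (up_closure X m S)"
  shows "sl_le m b y"
proof -
  have "up_closure X m S \<subseteq> {y \<in> topspace X. sl_le m b y}"
    using assms(1-3) le_trans by (fastforce simp: up_closure_def)
  then show ?thesis
    using closure_of_minimal[OF _ closedin_principal_filter[OF assms(2)]] assms(4) by blast
qed

lemma upper_bound_closure_down_closure:
  assumes "S \<subseteq> topspace X" "b \<in> topspace X" "\<forall>a\<in>S. sl_le m a b"
    and "y \<in> X closure_of (down_closure X m S)"
  shows "sl_le m y b"
proof -
  have "down_closure X m S \<subseteq> {y \<in> topspace X. sl_le m y b}"
    using assms(1-3) le_trans by (fastforce simp: down_closure_def)
  then show ?thesis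
    using closure_of_minimal[OF _ closedin_principal_ideal[OF assms(2)]] assms(4) by blast
qed

text \<open>If \<open>a\<close> and \<open>b\<close> in \<open>S\<close> lie below \<open>x\<close>
  and \<open>y\<close>, then \<open>m a b\<close> is in \<open>S\<close> and lies below
  \<open>m x y\<close>.\<close>

lemma subsemilattice_up_closure:
  assumes "subsemilattice X m S"
  shows "subsemilattice X m (up_closure X m S)"
proof -
  have "m x y \<in> up_closure X m S" if "x \<in> up_closure X m S" "y \<in> up_closure X m S" for x y
  proof -
    obtain a b where ab: "a \<in> S" "b \<in> S" "sl_le m a x" "sl_le m b y"
      and xy: "x \<in> topspace X" "y \<in> topspace X"
      using \<open>x \<in> _\<close> \<open>y \<in> _\<close> by (auto simp: up_closure_def)
    have mem: "m a b \<in> S" "a \<in> topspace X" "b \<in> topspace X"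
      using assms ab by (auto simp: subsemilattice_def)
    then have "sl_le m (m a b) x" "sl_le m (m a b) y"
      using ab xy by (meson closed le_trans meet_le1 meet_le2)+
    then have "sl_le m (m a b) (m x y)"
      using mem xy by (simp add: closed le_meet)
    with mem xy show ?thesis
      using closed by (auto simp: up_closure_def)
  qed
  then show ?thesis
    by (auto simp: subsemilattice_def up_closure_def)
qed

text \<open>The closure of \<open>S \<times> S\<close> is the product of the closures, and
  continuity of the operation sends it into the closure of the image, which lies in the closure of
  \<open>S\<close>.\<close>

lemma subsemilattice_closure:
  assumes "subsemilattice X m S"
  shows "subsemilattice X m (X closure_of S)"
proof -
  have "(\<lambda>(x, y). m x y) ` (prod_topology X X closure_of (S \<times> S))
      \<subseteq> X closure_of ((\<lambda>(x, y). m x y) ` (S \<times> S))"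
    by (rule continuous_map_image_closure_subset[OF continuous])
  also have "\<dots> \<subseteq> X closure_of S"
    using assms by (intro closure_of_mono) (auto simp: subsemilattice_def)
  finally show ?thesis
    by (auto simp: subsemilattice_def closure_of_Times closure_of_subset_topspace in_closure_of)
qed

lemma minimal_element_if_chain_inf_closed:
  assumes "F \<subseteq> topspace X" "F \<noteq> {}"
    and inf: "\<And>C. sl_chain X m C \<Longrightarrow> C \<noteq> {} \<Longrightarrow> C \<subseteq> F \<Longrightarrow> \<exists>x\<in>F. is_inf X m C x"
  obtains x where "x \<in> F" "\<And>y. y \<in> F \<Longrightarrow> sl_le m y x \<Longrightarrow> y = x"
proof -
  have "\<exists>x\<in>F. \<forall>y\<in>F. sl_le m y x \<longrightarrow> y = x"
  \<comment> \<open>The order is reversed, so that maximal elements become minimal ones and infima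
    of chains serve as the required bounds.\<close>
  proof (rule predicate_Zorn[where P = "\<lambda>x y. sl_le m y x"])
    show "partial_order_on F (relation_of (\<lambda>x y. sl_le m y x) F)"
      using assms(1) le_refl le_trans le_antisym
      by (intro partial_order_on_relation_ofI) blast+
  next
    fix C
    assume C: "C \<in> Chains (relation_of (\<lambda>x y. sl_le m y x) F)"
    then have tot: "sl_le m x y \<or> sl_le m y x" and "x \<in> F" if "x \<in> C" "y \<in> C" for x y
      using that by (auto simp: Chains_def relation_of_def)
    then have "C \<subseteq> F"
      by blast
    show "\<exists>u\<in>F. \<forall>a\<in>C. sl_le m u a"
    \<comment> \<open>The empty chain has no infimum supplied by \<open>inf\<close>; any element of
      \<open>F\<close> bounds it.\<close>
    proof (cases "C = {}")
      case False
      have "sl_chain X m C"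
        using \<open>C \<subseteq> F\<close> assms(1) tot by (auto simp: sl_chain_iff[OF semilattice])
      from inf[OF this False \<open>C \<subseteq> F\<close>] show ?thesis
        by (auto simp: is_inf_def)
    qed (use assms(2) in auto)
  qed
  with that show ?thesis
    by blast
qed

section \<open>From chains to subsemilattices\<close>

lemma k_complete_imp_s_complete:
  assumes k: "k_complete X m"
  shows "s_complete X m"
  unfolding s_complete_def
proof (intro conjI allI impI; elim conjE)
  fix S
  assume S: "subsemilattice X m S" and "S \<noteq> {}"
  define F where "F = X closure_of (up_closure X m S)"
  have ST: "S \<subseteq> topspace X"
    using S by (simp add: subsemilattice_def)
  have sub: "subsemilattice X m F"
    unfolding F_def using S by (intro subsemilattice_closure subsemilattice_up_closure)
  have FT: "F \<subseteq> topspace X"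
    using sub by (simp add: subsemilattice_def)
  have SF: "S \<subseteq> F"
    unfolding F_def using up_closure_superset[OF ST]
    by (rule order_trans) (auto intro!: closure_of_subset simp: up_closure_def)
  have "\<exists>x\<in>F. is_inf X m C x" if "sl_chain X m C" "C \<noteq> {}" "C \<subseteq> F" for C
  proof -
    have "X closure_of C \<subseteq> F"
      using \<open>C \<subseteq> F\<close> unfolding F_def by (intro closure_of_minimal) auto
    then show ?thesis
      using k that unfolding k_complete_def by blast
  qed
  then obtain x where x: "x \<in> F" "\<And>y. y \<in> F \<Longrightarrow> sl_le m y x \<Longrightarrow> y = x"
    using minimal_element_if_chain_inf_closed[of F] FT SF \<open>S \<noteq> {}\<close> by blast
  \<comment> \<open>Minimal implies least: \<open>m x y\<close> stays in \<open>F\<close> and lies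
    below \<open>x\<close>, so it equals \<open>x\<close>.\<close>
  have "sl_le m x y" if "y \<in> F" for y
  proof -
    have "m x y \<in> F"
      using sub x(1) that by (simp add: subsemilattice_def)
    with x FT that have "m x y = x"
      using meet_le1 by blast
    then show ?thesis
      by (simp add: sl_le_def)
  qed
  \<comment> \<open>Being least in \<open>F\<close>, \<open>x\<close> is below \<open>S\<close>;
    conversely a lower bound of \<open>S\<close> bounds all of \<open>F\<close>, in particular
    \<open>x\<close>.\<close>
  with x(1) SF FT ST have "is_inf X m S x"
    unfolding is_inf_def F_def by (blast intro: lower_bound_closure_up_closure)
  with x(1) show "\<exists>x. is_inf X m S x \<and> x \<in> X closure_of (up_closure X m S)"
    unfolding F_def by blast
next
  fix C
  assume C: "sl_chain X m C" "C \<noteq> {}"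
  then have "X closure_of C \<subseteq> X closure_of (down_closure X m C)"
    by (intro closure_of_mono down_closure_superset) (simp add: sl_chain_iff[OF semilattice])
  with C k show "\<exists>x. is_sup X m C x \<and> x \<in> X closure_of (down_closure X m C)"
    unfolding k_complete_def by blast
qed

section \<open>From subsemilattices to closed upper sets\<close>

lemma sl_chain_imp_subsemilattice:
  assumes "sl_chain X m C"
  shows "subsemilattice X m C"
  unfolding subsemilattice_def
proof (intro conjI ballI)
  show "C \<subseteq> topspace X"
    using assms by (simp add: sl_chain_iff[OF semilattice])
  fix x y
  assume xy: "x \<in> C" "y \<in> C"
  then have "x \<in> topspace X" "y \<in> topspace X" "m x y = x \<or> m y x = y"
    using assms unfolding sl_chain_iff[OF semilattice] sl_le_def by blast+
  with xy show "m x y \<in> C"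
    using commute by metis
qed

text \<open>A chain is a subsemilattice, and a closed upper set containing it also contains the
  closure of its upper set, where s-completeness places the infimum.\<close>

lemma s_complete_imp_c_complete:
  assumes s: "s_complete X m"
  shows "c_complete X m"
  unfolding c_complete_def
proof (intro allI impI; elim conjE; intro conjI)
  fix F C
  assume F: "closedin X F" "upper_set X m F" and C: "sl_chain X m C" "C \<noteq> {}" "C \<subseteq> F"
  have "up_closure X m C \<subseteq> up_closure X m F"
    using C(3) by (auto simp: up_closure_def)
  then have "X closure_of (up_closure X m C) \<subseteq> F"
    using F by (intro closure_of_minimal) (auto simp: upper_set_def)
  with s sl_chain_imp_subsemilattice[OF C(1)] C(2) show "\<exists>x. is_inf X m C x \<and> x \<in> F"
    unfolding s_complete_def by blast
  show "\<exists>x. is_sup X m C x \<and> x \<in> X closure_of (down_closure X m C)"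
    using s C unfolding s_complete_def by blast
qed

section \<open>Passing between a maximal chain and the whole space\<close>

lemma closed_upper_set_Int_subset:
  assumes "closedin X F" "upper_set X m F" "M \<subseteq> topspace X"
  shows "closedin (subtopology X M) (M \<inter> F)" "upper_set (subtopology X M) m (M \<inter> F)"
proof -
  show "closedin (subtopology X M) (M \<inter> F)"
    using assms(1) by (auto simp: closedin_subtopology)
  have "up_closure X m F \<subseteq> F"
    using assms(2) by (simp add: upper_set_def)
  then show "upper_set (subtopology X M) m (M \<inter> F)"
    using assms(3) le_refl unfolding upper_set_def up_closure_def topspace_subtopology by blast
qed

lemma upper_set_principal_filter:
  assumes "b \<in> topspace X"
  shows "upper_set X m {y \<in> topspace X. sl_le m b y}"
  using assms le_refl le_trans by (auto simp: upper_set_def up_closure_def)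

text \<open>c-completeness of \<open>M\<close> yields an infimum for each closed upper set
  separately; uniqueness makes them one point lying in all these sets.\<close>

lemma is_inf_unique:
  assumes "is_inf (subtopology X M) m C x" "is_inf (subtopology X M) m C y"
  shows "x = y"
  using assms le_antisym by (auto simp: is_inf_def)

lemma c_complete_if_maximal_chains_c_complete:
  assumes c: "\<And>M. sl_maximal_chain X m M \<Longrightarrow> c_complete (subtopology X M) m"
  shows "c_complete X m"
  unfolding c_complete_def
proof (intro allI impI; elim conjE)
  fix F C
  assume F: "closedin X F" "upper_set X m F" and C: "sl_chain X m C" "C \<noteq> {}" "C \<subseteq> F"
  obtain M where M: "sl_maximal_chain X m M" "C \<subseteq> M"
    using sl_maximal_chain_extends[OF C(1)] .
  have MT: "M \<subseteq> topspace X"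
    using M(1) by (simp add: pred_on.maxchain_def pred_on.chain_def)
  have CT: "C \<subseteq> topspace X"
    using M(2) MT by blast
  have chain: "sl_chain (subtopology X M) m C"
    using C(1) M(2) by (auto simp: pred_on.chain_def)
  \<comment> \<open>\<open>G\<close> is left general, since it is taken both as \<open>F\<close> and
    as the principal filter of a lower bound of \<open>C\<close>.\<close>
  have complete: "(\<exists>x. is_inf (subtopology X M) m C x \<and> x \<in> G)
      \<and> (\<exists>x. is_sup (subtopology X M) m C x
            \<and> x \<in> subtopology X M closure_of (down_closure (subtopology X M) m C))"
    if "closedin X G" "upper_set X m G" "C \<subseteq> G" for G
    using c[OF M(1)] closed_upper_set_Int_subset[OF that(1,2) MT] chain C(2) that(3) M(2)
    unfolding c_complete_def by (metis IntD2 Int_greatest)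
  obtain x where x: "is_inf (subtopology X M) m C x" "x \<in> F"
    using complete[OF F C(3)] by blast
  have "sl_le m b x" if b: "b \<in> topspace X" "\<forall>a\<in>C. sl_le m b a" for b
  proof -
    have "C \<subseteq> {y \<in> topspace X. sl_le m b y}"
      using CT b(2) by blast
    from complete[OF closedin_principal_filter[OF b(1)] upper_set_principal_filter[OF b(1)] this]
    show ?thesis
      using is_inf_unique[OF x(1)] by blast
  qed
  with x have "is_inf X m C x"
    by (auto simp: is_inf_def)
  obtain y where y: "is_sup (subtopology X M) m C y"
    "y \<in> subtopology X M closure_of (down_closure (subtopology X M) m C)"
    using complete[OF F C(3)] by blast
  have "down_closure (subtopology X M) m C \<subseteq> down_closure X m C"
    by (auto simp: down_closure_def)
  then have yc: "y \<in> X closure_of (down_closure X m C)"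
    using y(2) closure_of_subtopology_subset closure_of_mono by (metis subsetD)
  \<comment> \<open>An upper bound of \<open>C\<close> in \<open>X\<close> may lie outside
    \<open>M\<close>, but its principal ideal is closed and contains the lower set of
    \<open>C\<close>, hence also \<open>y\<close>.\<close>
  then have "is_sup X m C y"
    using y(1) CT upper_bound_closure_down_closure by (auto simp: is_sup_def)
  with yc x(2) \<open>is_inf X m C x\<close>
  show "(\<exists>x. is_inf X m C x \<and> x \<in> F)
      \<and> (\<exists>x. is_sup X m C x \<and> x \<in> X closure_of (down_closure X m C))"
    by blast
qed

end

theorem proposition9p1:
  fixes X :: "'a topology" and m :: "'a \<Rightarrow> 'a \<Rightarrow> 'a"
  assumes "topological_semilattice X m"
    and "Hausdorff_space X"
  shows "(k_complete X m \<longrightarrow> s_complete X m) \<and>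
         (s_complete X m \<longrightarrow> c_complete X m) \<and>
         ((\<forall>M. sl_maximal_chain X m M \<longrightarrow> c_complete (subtopology X M) m) \<longrightarrow> c_complete X m)"
proof -
  interpret hausdorff_semilattice X m
    using assms by unfold_locales
  show ?thesis
    using k_complete_imp_s_complete s_complete_imp_c_complete
      c_complete_if_maximal_chains_c_complete by blast
qed

end
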